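(* Let $\pi:(M,g,J)\to(N,g_N)$ be a proper bi-slant submersion from a Kähler manifold onto a Riemannian manifold. Then $(\ker\pi_* )^\perp$ defines a totally geodesic foliation on $M$ if and only if $$\phi\big(\mathcal A_\xi\phi\eta+\mathcal H\nabla_\xi\omega\eta\big)+P\big(\mathcal A_\xi\omega\eta+\mathcal V\nabla_\xi\phi\eta\big)=0$$ for all horizontal vector fields $\xi,\eta\in(\ker\pi_* )^\perp$.
   Context: All objects are smooth. A Riemannian submersion $\pi:(M,g)\to(N,g_N)$, $\dim M>\dim N$, is a surjective map of maximal rank such that $\pi_*$ restricted to $(\ker\pi_* )^\perp$ is a linear isometry. Vector fields in $\ker\pi_*$ are vertical, those in $(\ker\pi_* )^\perp$ horizontal; $\mathcal V,\mathcal H$ are the orthogonal projections onto $\ker\pi_*$ and $(\ker\pi_* )^\perp$. $\nabla$ is the Levi-Civita connection of $g$. O'Neill's tensor $\mathcal A$ is $\mathcal A_E G=\mathcal V\nabla_{\mathcal H E}\mathcal H G+\mathcal H\nabla_{\mathcal H E}\mathcal V G$. Kähler means $J^2=-I$, $g(JX,JY)=g(X,Y)$, $\nabla J=0$. For vertical $V$ write $JV=PV+FV$ with $PV$ vertical and $FV$ horizontal; for horizontal $\xi$ write $J\xi=\phi\xi+\omega\xi$ with $\phi\xi$ vertical and $\omega\xi$ horizontal. A distribution $\mathcal D$ is slant with slant angle $\theta$ if for every point $p$ and every nonzero $X\in\mathcal D_p$ the angle between $JX$ and $\mathcal D_p$ equals the constant $\theta$. $\pi$ is a bi-slant submersion if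 $\ker\pi_*=\mathcal D^{\theta_1}\oplus\mathcal D^{\theta_2}$ (orthogonal direct sum), where $\mathcal D^{\theta_i}$ is slant with slant angle $\theta_i$ and $P\mathcal D^{\theta_i}\subset\mathcal D^{\theta_i}$, $i=1,2$. It is proper if neither slant angle is $0$ or $\pi/2$, i.e. $\theta_1,\theta_2\in(0,\pi/2)$. A distribution $\mathcal D$ on $M$ defines a totally geodesic foliation if $\nabla_X Y\in\mathcal D$ for all vector fields $X,Y\in\mathcal D$. *)

theory Defs
  imports "HOL-Analysis.Analysis" "HOL-Library.Function_Algebras"
begin

section \<open>Functions as a real vector space\<close>

text \<open>Tangent vectors will be real-valued functionals; pointwise scalar multiplication makes the
  library's span, independence and so on available for them.\<close>

instantiation "fun" :: (type, real_vector) real_vector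
begin

definition scaleR_fun :: "real \<Rightarrow> ('a \<Rightarrow> 'b) \<Rightarrow> 'a \<Rightarrow> 'b" where
  "scaleR_fun c f = (\<lambda>x. c *\<^sub>R f x)"

instance
  by standard (simp_all add: scaleR_fun_def fun_eq_iff scaleR_add_right scaleR_add_left)

end

definition linear_map_on :: "'a::real_vector set \<Rightarrow> ('a \<Rightarrow> 'b::real_vector) \<Rightarrow> bool" where
  "linear_map_on S f \<longleftrightarrow>
     (\<forall>u\<in>S. \<forall>v\<in>S. f (u + v) = f u + f v) \<and> (\<forall>c. \<forall>u\<in>S. f (c *\<^sub>R u) = c *\<^sub>R f u)"


section \<open>Smooth manifolds\<close>

fun Ck_on :: "nat \<Rightarrow> 'a::real_normed_vector set \<Rightarrow> ('a \<Rightarrow> 'b::real_normed_vector) \<Rightarrow> bool" where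
  "Ck_on 0 S f \<longleftrightarrow> continuous_on S f"
| "Ck_on (Suc k) S f \<longleftrightarrow>
     (\<forall>x\<in>S. f differentiable (at x)) \<and> (\<forall>v. Ck_on k S (\<lambda>x. frechet_derivative f (at x) v))"

text \<open>Only used for open \<open>S\<close>.\<close>

definition smooth_on :: "'a::real_normed_vector set \<Rightarrow> ('a \<Rightarrow> 'b::real_normed_vector) \<Rightarrow> bool" where
  "smooth_on S f \<longleftrightarrow> (\<forall>k. Ck_on k S f)"

text \<open>A manifold is the whole of a Hausdorff, second countable type \<open>'m\<close>, with an atlas of charts
  \<open>(U, x)\<close> into the Euclidean space \<open>'e\<close>; its dimension is \<open>DIM('e)\<close>. Dimension \<open>0\<close> is thereby
  excluded.\<close>

type_synonym ('m, 'e) atlas = "('m set \<times> ('m \<Rightarrow> 'e)) set"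

definition smooth_atlas ::
  "('m::{t2_space, second_countable_topology}, 'e::euclidean_space) atlas \<Rightarrow> bool" where
  "smooth_atlas A \<longleftrightarrow>
     (\<Union>(U, x)\<in>A. U) = UNIV \<and>
     (\<forall>(U, x)\<in>A. open U \<and> open (x ` U) \<and> homeomorphism U (x ` U) x (inv_into U x)) \<and>
     (\<forall>(U, x)\<in>A. \<forall>(V, y)\<in>A. smooth_on (x ` (U \<inter> V)) (y \<circ> inv_into U x))"

definition smooth_fun_on ::
  "('m, 'e::euclidean_space) atlas \<Rightarrow> 'm set \<Rightarrow> ('m \<Rightarrow> real) \<Rightarrow> bool" where
  "smooth_fun_on A W f \<longleftrightarrow> (\<forall>(U, x)\<in>A. smooth_on (x ` (U \<inter> W)) (f \<circ> inv_into U x))"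

abbreviation smooth_fun :: "('m, 'e::euclidean_space) atlas \<Rightarrow> ('m \<Rightarrow> real) \<Rightarrow> bool" where
  "smooth_fun A \<equiv> smooth_fun_on A UNIV"

definition smooth_map ::
  "('m::topological_space, 'e::euclidean_space) atlas \<Rightarrow>
   ('n::topological_space, 'f::euclidean_space) atlas \<Rightarrow> ('m \<Rightarrow> 'n) \<Rightarrow> bool" where
  "smooth_map A B F \<longleftrightarrow>
     continuous_on UNIV F \<and>
     (\<forall>(U, x)\<in>A. \<forall>(V, y)\<in>B. smooth_on (x ` (U \<inter> F -` V)) (y \<circ> F \<circ> inv_into U x))"


section \<open>Tangent vectors, vector fields and distributions\<close>

text \<open>Tangent vectors at \<open>p\<close> are the derivations at \<open>p\<close> of the algebra of smooth functions,
  extended by \<open>0\<close> to non-smooth functions so that equality is equality of derivations.\<close>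

type_synonym 'm tvec = "('m \<Rightarrow> real) \<Rightarrow> real"
type_synonym 'm vfield = "'m \<Rightarrow> 'm tvec"
type_synonym 'm distrib = "'m \<Rightarrow> 'm tvec set"
type_synonym 'm endo = "'m \<Rightarrow> 'm tvec \<Rightarrow> 'm tvec"
type_synonym 'm metric = "'m \<Rightarrow> 'm tvec \<Rightarrow> 'm tvec \<Rightarrow> real"
type_synonym 'm conn = "'m vfield \<Rightarrow> 'm vfield \<Rightarrow> 'm vfield"

definition tangent_space :: "('m, 'e::euclidean_space) atlas \<Rightarrow> 'm distrib" where
  "tangent_space A p =
     {v. linear_map_on {f. smooth_fun A f} v \<and>
         (\<forall>f g. smooth_fun A f \<and> smooth_fun A g \<longrightarrow> v (f * g) = f p * v g + g p * v f) \<and>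
         (\<forall>f. \<not> smooth_fun A f \<longrightarrow> v f = 0)}"

definition differential ::
  "('n, 'f::euclidean_space) atlas \<Rightarrow> ('m \<Rightarrow> 'n) \<Rightarrow> 'm tvec \<Rightarrow> 'n tvec" where
  "differential B F v = (\<lambda>f. if smooth_fun B f then v (f \<circ> F) else 0)"

definition vector_field_on ::
  "('m, 'e::euclidean_space) atlas \<Rightarrow> 'm set \<Rightarrow> 'm vfield \<Rightarrow> bool" where
  "vector_field_on A U X \<longleftrightarrow>
     (\<forall>p\<in>U. X p \<in> tangent_space A p) \<and>
     (\<forall>f. smooth_fun A f \<longrightarrow> smooth_fun_on A U (\<lambda>p. X p f))"

abbreviation vector_field :: "('m, 'e::euclidean_space) atlas \<Rightarrow> 'm vfield \<Rightarrow> bool" where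
  "vector_field A \<equiv> vector_field_on A UNIV"

definition lie_bracket :: "'m vfield \<Rightarrow> 'm vfield \<Rightarrow> 'm vfield" where
  "lie_bracket X Y = (\<lambda>p f. X p (\<lambda>q. Y q f) - Y p (\<lambda>q. X q f))"

definition apply_endo :: "'m endo \<Rightarrow> 'm vfield \<Rightarrow> 'm vfield"  (infixr "\<diamondop>" 75) where
  "T \<diamondop> X = (\<lambda>p. T p (X p))"

text \<open>A smooth distribution: a subbundle of constant rank \<open>k\<close> with smooth local frames.\<close>

definition smooth_distribution ::
  "('m::topological_space, 'e::euclidean_space) atlas \<Rightarrow> 'm distrib \<Rightarrow> bool" where
  "smooth_distribution A D \<longleftrightarrow>
     (\<exists>k::nat. \<forall>p. \<exists>U X. open U \<and> p \<in> U \<and> (\<forall>i<k. vector_field_on A U (X i)) \<and>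
        (\<forall>q\<in>U. inj_on (\<lambda>i. X i q) {..<k} \<and>
           independent ((\<lambda>i. X i q) ` {..<k}) \<and> span ((\<lambda>i. X i q) ` {..<k}) = D q))"

definition section_of ::
  "('m, 'e::euclidean_space) atlas \<Rightarrow> 'm distrib \<Rightarrow> 'm vfield \<Rightarrow> bool" where
  "section_of A D X \<longleftrightarrow> vector_field A X \<and> (\<forall>p. X p \<in> D p)"


section \<open>Riemannian metrics and the Levi-Civita connection\<close>

definition riemannian_metric ::
  "('m::topological_space, 'e::euclidean_space) atlas \<Rightarrow> 'm metric \<Rightarrow> bool" where
  "riemannian_metric A g \<longleftrightarrow>
     (\<forall>p. (\<forall>u\<in>tangent_space A p. linear_map_on (tangent_space A p) (g p u)) \<and>
          (\<forall>u\<in>tangent_space A p. \<forall>v\<in>tangent_space A p. g p u v = g p v u) \<and>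
          (\<forall>u\<in>tangent_space A p. u \<noteq> 0 \<longrightarrow> g p u u > 0)) \<and>
     (\<forall>U X Y. open U \<and> vector_field_on A U X \<and> vector_field_on A U Y \<longrightarrow>
        smooth_fun_on A U (\<lambda>p. g p (X p) (Y p)))"

definition riemannian_manifold ::
  "('m::{t2_space, second_countable_topology}, 'e::euclidean_space) atlas \<Rightarrow> 'm metric \<Rightarrow> bool"
  where
  "riemannian_manifold A g \<longleftrightarrow> smooth_atlas A \<and> riemannian_metric A g"

text \<open>The first five conditions say that \<open>nabla\<close> is a linear connection on the module of global
  smooth vector fields; the last two say that it is torsion-free and metric. Together they determine
  \<open>nabla X Y\<close> for all smooth \<open>X\<close>, \<open>Y\<close>.\<close>

definition levi_civita ::
  "('m, 'e::euclidean_space) atlas \<Rightarrow> 'm metric \<Rightarrow> 'm conn \<Rightarrow> bool" where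
  "levi_civita A g nabla \<longleftrightarrow>
     (\<forall>X Y. vector_field A X \<and> vector_field A Y \<longrightarrow> vector_field A (nabla X Y)) \<and>
     (\<forall>X X' Y. vector_field A X \<and> vector_field A X' \<and> vector_field A Y \<longrightarrow>
        nabla (X + X') Y = nabla X Y + nabla X' Y) \<and>
     (\<forall>f X Y. smooth_fun A f \<and> vector_field A X \<and> vector_field A Y \<longrightarrow>
        nabla (\<lambda>p. f p *\<^sub>R X p) Y = (\<lambda>p. f p *\<^sub>R nabla X Y p)) \<and>
     (\<forall>X Y Y'. vector_field A X \<and> vector_field A Y \<and> vector_field A Y' \<longrightarrow>
        nabla X (Y + Y') = nabla X Y + nabla X Y') \<and>
     (\<forall>f X Y. smooth_fun A f \<and> vector_field A X \<and> vector_field A Y \<longrightarrow>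
        nabla X (\<lambda>p. f p *\<^sub>R Y p) = (\<lambda>p. X p f *\<^sub>R Y p + f p *\<^sub>R nabla X Y p)) \<and>
     (\<forall>X Y. vector_field A X \<and> vector_field A Y \<longrightarrow>
        nabla X Y - nabla Y X = lie_bracket X Y) \<and>
     (\<forall>X Y Z. vector_field A X \<and> vector_field A Y \<and> vector_field A Z \<longrightarrow>
        (\<forall>p. X p (\<lambda>q. g q (Y q) (Z q)) =
             g p (nabla X Y p) (Z p) + g p (Y p) (nabla X Z p)))"

definition totally_geodesic_foliation ::
  "('m, 'e::euclidean_space) atlas \<Rightarrow> 'm conn \<Rightarrow> 'm distrib \<Rightarrow> bool" where
  "totally_geodesic_foliation A nabla D \<longleftrightarrow>
     (\<forall>X Y. section_of A D X \<and> section_of A D Y \<longrightarrow> section_of A D (nabla X Y))"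

text \<open>For an inner product \<open>b\<close>, e.g. \<open>g p\<close>. The angle between \<open>v\<close> and a subspace \<open>W\<close> is the angle
  in \<open>[0, pi/2]\<close> between \<open>v\<close> and its orthogonal projection to \<open>W\<close>, and \<open>pi/2\<close> if the projection
  vanishes.\<close>

definition orth_proj ::
  "('v::real_vector \<Rightarrow> 'v \<Rightarrow> real) \<Rightarrow> 'v set \<Rightarrow> 'v \<Rightarrow> 'v" where
  "orth_proj b W v = (THE u. u \<in> W \<and> (\<forall>w\<in>W. b (v - u) w = 0))"

definition angle_to_subspace ::
  "('v::real_vector \<Rightarrow> 'v \<Rightarrow> real) \<Rightarrow> 'v \<Rightarrow> 'v set \<Rightarrow> real" where
  "angle_to_subspace b v W =
     (let u = orth_proj b W v in arccos (sqrt (b u u) / sqrt (b v v)))"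


section \<open>Kaehler manifolds\<close>

definition smooth_endo ::
  "('m::topological_space, 'e::euclidean_space) atlas \<Rightarrow> 'm endo \<Rightarrow> bool" where
  "smooth_endo A T \<longleftrightarrow>
     (\<forall>p. T p ` tangent_space A p \<subseteq> tangent_space A p \<and>
          linear_map_on (tangent_space A p) (T p)) \<and>
     (\<forall>U X. open U \<and> vector_field_on A U X \<longrightarrow> vector_field_on A U (T \<diamondop> X))"

definition kaehler_manifold ::
  "('m::{t2_space, second_countable_topology}, 'e::euclidean_space) atlas \<Rightarrow>
   'm metric \<Rightarrow> 'm endo \<Rightarrow> 'm conn \<Rightarrow> bool" where
  "kaehler_manifold A g J nabla \<longleftrightarrow>
     riemannian_manifold A g \<and> levi_civita A g nabla \<and> smooth_endo A J \<and>
     (\<forall>p. \<forall>u\<in>tangent_space A p. J p (J p u) = - u) \<and>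
     (\<forall>p. \<forall>u\<in>tangent_space A p. \<forall>v\<in>tangent_space A p. g p (J p u) (J p v) = g p u v) \<and>
     (\<forall>X Y. vector_field A X \<and> vector_field A Y \<longrightarrow> nabla X (J \<diamondop> Y) = J \<diamondop> nabla X Y)"


section \<open>Riemannian submersions\<close>

definition vertical ::
  "('m, 'e::euclidean_space) atlas \<Rightarrow> ('n, 'f::euclidean_space) atlas \<Rightarrow> ('m \<Rightarrow> 'n) \<Rightarrow> 'm distrib"
  where
  "vertical A B F p = {v \<in> tangent_space A p. differential B F v = 0}"

definition horizontal ::
  "('m, 'e::euclidean_space) atlas \<Rightarrow> 'm metric \<Rightarrow> ('n, 'f::euclidean_space) atlas \<Rightarrow>
   ('m \<Rightarrow> 'n) \<Rightarrow> 'm distrib" where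
  "horizontal A g B F p = {v \<in> tangent_space A p. \<forall>w\<in>vertical A B F p. g p v w = 0}"

text \<open>Maximal rank is surjectivity of the differential, as \<open>DIM('f) < DIM('e)\<close>.\<close>

definition riemannian_submersion ::
  "('m::{t2_space, second_countable_topology}, 'e::euclidean_space) atlas \<Rightarrow> 'm metric \<Rightarrow>
   ('n::{t2_space, second_countable_topology}, 'f::euclidean_space) atlas \<Rightarrow> 'n metric \<Rightarrow>
   ('m \<Rightarrow> 'n) \<Rightarrow> bool" where
  "riemannian_submersion A g B h F \<longleftrightarrow>
     riemannian_manifold A g \<and> riemannian_manifold B h \<and> DIM('f) < DIM('e) \<and>
     smooth_map A B F \<and> surj F \<and>
     (\<forall>p. differential B F ` tangent_space A p = tangent_space B (F p)) \<and>
     (\<forall>p. \<forall>u\<in>horizontal A g B F p. \<forall>v\<in>horizontal A g B F p.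
        h (F p) (differential B F u) (differential B F v) = g p u v)"

definition ver_proj ::
  "('m, 'e::euclidean_space) atlas \<Rightarrow> 'm metric \<Rightarrow> ('n, 'f::euclidean_space) atlas \<Rightarrow>
   ('m \<Rightarrow> 'n) \<Rightarrow> 'm endo" where
  "ver_proj A g B F p = orth_proj (g p) (vertical A B F p)"

definition hor_proj ::
  "('m, 'e::euclidean_space) atlas \<Rightarrow> 'm metric \<Rightarrow> ('n, 'f::euclidean_space) atlas \<Rightarrow>
   ('m \<Rightarrow> 'n) \<Rightarrow> 'm endo" where
  "hor_proj A g B F p = orth_proj (g p) (horizontal A g B F p)"

definition oneill_A ::
  "('m, 'e::euclidean_space) atlas \<Rightarrow> 'm metric \<Rightarrow> 'm conn \<Rightarrow>
   ('n, 'f::euclidean_space) atlas \<Rightarrow> ('m \<Rightarrow> 'n) \<Rightarrow> 'm conn" where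
  "oneill_A A g nabla B F E G =
     (let \<V> = ver_proj A g B F; \<H> = hor_proj A g B F in
        \<V> \<diamondop> nabla (\<H> \<diamondop> E) (\<H> \<diamondop> G) + \<H> \<diamondop> nabla (\<H> \<diamondop> E) (\<V> \<diamondop> G))"


section \<open>Bi-slant submersions\<close>

text \<open>\<open>P V\<close> is the vertical part of \<open>J V\<close> for vertical \<open>V\<close>; \<open>\<phi> \<xi>\<close> and \<open>\<omega> \<xi>\<close> are the vertical and
  horizontal parts of \<open>J \<xi>\<close> for horizontal \<open>\<xi>\<close>. Thus \<open>P\<close> and \<open>\<phi>\<close> are given by the same formula,
  but are meant for vertical and horizontal arguments, respectively.\<close>

definition P_part ::
  "('m, 'e::euclidean_space) atlas \<Rightarrow> 'm metric \<Rightarrow> 'm endo \<Rightarrow>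
   ('n, 'f::euclidean_space) atlas \<Rightarrow> ('m \<Rightarrow> 'n) \<Rightarrow> 'm endo" where
  "P_part A g J B F p v = ver_proj A g B F p (J p v)"

definition phi_part ::
  "('m, 'e::euclidean_space) atlas \<Rightarrow> 'm metric \<Rightarrow> 'm endo \<Rightarrow>
   ('n, 'f::euclidean_space) atlas \<Rightarrow> ('m \<Rightarrow> 'n) \<Rightarrow> 'm endo" where
  "phi_part A g J B F p v = ver_proj A g B F p (J p v)"

definition omega_part ::
  "('m, 'e::euclidean_space) atlas \<Rightarrow> 'm metric \<Rightarrow> 'm endo \<Rightarrow>
   ('n, 'f::euclidean_space) atlas \<Rightarrow> ('m \<Rightarrow> 'n) \<Rightarrow> 'm endo" where
  "omega_part A g J B F p v = hor_proj A g B F p (J p v)"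

definition slant :: "'m metric \<Rightarrow> 'm endo \<Rightarrow> 'm distrib \<Rightarrow> real \<Rightarrow> bool" where
  "slant g J D \<theta> \<longleftrightarrow>
     (\<forall>p. \<forall>v\<in>D p. v \<noteq> 0 \<longrightarrow> angle_to_subspace (g p) (J p v) (D p) = \<theta>)"

definition bi_slant_submersion ::
  "('m::{t2_space, second_countable_topology}, 'e::euclidean_space) atlas \<Rightarrow>
   'm metric \<Rightarrow> 'm endo \<Rightarrow>
   ('n::{t2_space, second_countable_topology}, 'f::euclidean_space) atlas \<Rightarrow> 'n metric \<Rightarrow>
   ('m \<Rightarrow> 'n) \<Rightarrow> 'm distrib \<Rightarrow> 'm distrib \<Rightarrow> real \<Rightarrow> real \<Rightarrow> bool" where
  "bi_slant_submersion A g J B h F D1 D2 \<theta>1 \<theta>2 \<longleftrightarrow>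
     riemannian_submersion A g B h F \<and>
     smooth_distribution A D1 \<and> smooth_distribution A D2 \<and>
     (\<forall>p. vertical A B F p = {u + v |u v. u \<in> D1 p \<and> v \<in> D2 p} \<and>
          (\<forall>u\<in>D1 p. \<forall>v\<in>D2 p. g p u v = 0)) \<and>
     slant g J D1 \<theta>1 \<and> slant g J D2 \<theta>2 \<and>
     (\<forall>p. P_part A g J B F p ` D1 p \<subseteq> D1 p \<and> P_part A g J B F p ` D2 p \<subseteq> D2 p)"

definition proper_bi_slant_submersion ::
  "('m::{t2_space, second_countable_topology}, 'e::euclidean_space) atlas \<Rightarrow>
   'm metric \<Rightarrow> 'm endo \<Rightarrow>
   ('n::{t2_space, second_countable_topology}, 'f::euclidean_space) atlas \<Rightarrow> 'n metric \<Rightarrow>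
   ('m \<Rightarrow> 'n) \<Rightarrow> 'm distrib \<Rightarrow> 'm distrib \<Rightarrow> real \<Rightarrow> real \<Rightarrow> bool" where
  "proper_bi_slant_submersion A g J B h F D1 D2 \<theta>1 \<theta>2 \<longleftrightarrow>
     bi_slant_submersion A g J B h F D1 D2 \<theta>1 \<theta>2 \<and>
     \<theta>1 \<in> {0<..<pi / 2} \<and> \<theta>2 \<in> {0<..<pi / 2}"

end

theory Submission
  imports Defs
begin

text \<open>Let \<open>\<xi>\<close>, \<open>\<eta>\<close> be horizontal. As \<open>\<phi> \<eta>\<close> is vertical and \<open>\<omega> \<eta>\<close> is horizontal, the two brackets
  are the horizontal and vertical parts of \<open>nabla \<xi> (\<phi> \<eta> + \<omega> \<eta>) = nabla \<xi> (J \<eta>) = J (nabla \<xi> \<eta>)\<close>.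
  Since \<open>\<phi>\<close> and \<open>P\<close> both take the vertical part after \<open>J\<close>, the whole expression is the vertical
  part of \<open>J (J (nabla \<xi> \<eta>))\<close>, that is minus the vertical part of \<open>nabla \<xi> \<eta>\<close>.

  The connection acts on smooth fields only, so \<open>\<phi> \<eta>\<close> and \<open>\<omega> \<eta>\<close> have to be shown smooth; this
  comes from a Gram-Schmidt process without normalization on local frames of \<open>D1\<close> and \<open>D2\<close>.\<close>

section \<open>Calculus of smooth functions\<close>

lemma Ck_on_subset: "Ck_on k S f \<Longrightarrow> T \<subseteq> S \<Longrightarrow> Ck_on k T f"
  by (induction k arbitrary: f) (auto intro: continuous_on_subset)

text \<open>The recursion for \<open>Ck_on\<close> constrains only the directional derivatives, so
  the lower order for \<open>f\<close> itself needs its own induction, whose base case is that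
  differentiability gives continuity.\<close>

lemma Ck_on_SucD: "Ck_on (Suc k) S f \<Longrightarrow> Ck_on k S f"
proof (induction k arbitrary: f)
  case 0
  then show ?case
    by (auto intro!: continuous_at_imp_continuous_on differentiable_imp_continuous_within)
next
  case (Suc k)
  then show ?case by (metis Ck_on.simps(2))
qed

text \<open>On an open set, values on \<open>S\<close> already determine the derivatives at points
  of \<open>S\<close>. This makes the junk values of inverse charts outside their domain
  harmless.\<close>

lemma Ck_on_cong:
  assumes "open S" "\<And>x. x \<in> S \<Longrightarrow> f x = g x" "Ck_on k S f"
  shows "Ck_on k S g"
  using assms(2,3)
proof (induction k arbitrary: f g)
  case 0
  then show ?case by (auto cong: continuous_on_cong)
next
  case (Suc k)
  have der: "(g has_derivative frechet_derivative f (at x)) (at x)" if "x \<in> S" for x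
  proof -
    have "(f has_derivative frechet_derivative f (at x)) (at x)"
      using Suc.prems(2) that by (simp add: frechet_derivative_works)
    then show ?thesis
      using has_derivative_transform_within_open[OF _ assms(1) that, of f] Suc.prems(1) by blast
  qed
  then have "g differentiable (at x)" if "x \<in> S" for x
    using that by (auto simp: differentiable_def)
  moreover have "Ck_on k S (\<lambda>x. frechet_derivative g (at x) v)" for v
    by (rule Suc.IH[of "\<lambda>x. frechet_derivative f (at x) v"])
      (use Suc.prems(2) frechet_derivative_at[OF der] in auto)
  ultimately show ?case by simp
qed

text \<open>Replaces \<open>frechet_derivative\<close>, which is defined by choice, by an explicit
  derivative. The inductive steps of the closure lemmas below all go through it.\<close>

lemma Ck_on_Suc_intro:
  assumes "open S"
    and "\<And>x. x \<in> S \<Longrightarrow> (f has_derivative f' x) (at x)"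
    and "\<And>v. Ck_on k S (\<lambda>x. f' x v)"
  shows "Ck_on (Suc k) S f"
proof -
  have "Ck_on k S (\<lambda>x. frechet_derivative f (at x) v)" for v
    by (rule Ck_on_cong[OF assms(1) _ assms(3)[of v]])
      (use frechet_derivative_at[OF assms(2)] in auto)
  then show ?thesis
    using assms(2) by (auto simp: differentiable_def)
qed

lemma Ck_on_Suc_has_derivative:
  "Ck_on (Suc k) S f \<Longrightarrow> x \<in> S \<Longrightarrow> (f has_derivative frechet_derivative f (at x)) (at x)"
  by (simp add: frechet_derivative_works)

lemma Ck_on_const: "open S \<Longrightarrow> Ck_on k S (\<lambda>x. c)"
proof (induction k arbitrary: c)
  case (Suc k)
  show ?case
    by (rule Ck_on_Suc_intro[OF Suc.prems has_derivative_const]) (rule Suc.IH[OF Suc.prems])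
qed simp

lemma Ck_on_add:
  "open S \<Longrightarrow> Ck_on k S f \<Longrightarrow> Ck_on k S g \<Longrightarrow> Ck_on k S (\<lambda>x. f x + g x)"
proof (induction k arbitrary: f g)
  case 0
  then show ?case by (auto intro: continuous_on_add)
next
  case (Suc k)
  show ?case
    by (rule Ck_on_Suc_intro[OF Suc.prems(1)
          has_derivative_add[OF Suc.prems(2)[THEN Ck_on_Suc_has_derivative]
            Suc.prems(3)[THEN Ck_on_Suc_has_derivative]]])
      (use Suc in auto)
qed

lemma Ck_on_mult:
  fixes f g :: "'a::real_normed_vector \<Rightarrow> real"
  shows "open S \<Longrightarrow> Ck_on k S f \<Longrightarrow> Ck_on k S g \<Longrightarrow> Ck_on k S (\<lambda>x. f x * g x)"
proof (induction k arbitrary: f g)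
  case 0
  then show ?case by (auto intro: continuous_on_mult)
next
  case (Suc k)
  \<comment> \<open>The product rule also contains the undifferentiated factors, which are therefore
    needed at order \<open>k\<close>.\<close>
  have "Ck_on k S f" "Ck_on k S g"
    using Suc.prems Ck_on_SucD by blast+
  then show ?case
    by (intro Ck_on_Suc_intro[OF Suc.prems(1)
          has_derivative_mult[OF Suc.prems(2)[THEN Ck_on_Suc_has_derivative]
            Suc.prems(3)[THEN Ck_on_Suc_has_derivative]]])
      (use Suc in \<open>auto intro!: Ck_on_add\<close>)
qed

lemma Ck_on_inverse:
  fixes f :: "'a::real_normed_vector \<Rightarrow> real"
  shows "open S \<Longrightarrow> (\<And>x. x \<in> S \<Longrightarrow> f x \<noteq> 0) \<Longrightarrow> Ck_on k S f \<Longrightarrow> Ck_on k S (\<lambda>x. inverse (f x))"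
proof (induction k)
  case 0
  then show ?case by (auto intro: continuous_on_inverse)
next
  case (Suc k)
  have inv: "Ck_on k S (\<lambda>x. inverse (f x))"
    using Suc Ck_on_SucD by blast
  \<comment> \<open>This is the derivative of the reciprocal, with its sign written as the factor
    \<open>- 1\<close> so that the product and constant rules cover it.\<close>
  have "Ck_on k S (\<lambda>x. - 1 * (inverse (f x) * frechet_derivative f (at x) v * inverse (f x)))" for v
    using Suc.prems inv by (intro Ck_on_mult Ck_on_const) auto
  then show ?case
    by (intro Ck_on_Suc_intro[OF Suc.prems(1)
          Deriv.has_derivative_inverse[OF Suc.prems(2) Suc.prems(3)[THEN Ck_on_Suc_has_derivative]]])
      auto
qed

text \<open>Continuity and derivatives at a point depend only on the germ there. The neighbourhoods
  \<open>T\<close> need not lie inside \<open>S\<close>.\<close>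

lemma Ck_on_local:
  assumes "\<And>x. x \<in> S \<Longrightarrow> \<exists>T. open T \<and> x \<in> T \<and> Ck_on k T f"
  shows "Ck_on k S f"
  using assms
proof (induction k arbitrary: f)
  case 0
  then show ?case
    by (auto intro!: continuous_at_imp_continuous_on)
      (metis at_within_open continuous_on_eq_continuous_within)
next
  case (Suc k)
  have "f differentiable (at x)" if "x \<in> S" for x
    using Suc.prems[OF that] by auto
  moreover have "Ck_on k S (\<lambda>x. frechet_derivative f (at x) v)" for v
    by (rule Suc.IH) (use Suc.prems in fastforce)
  ultimately show ?case by simp
qed

section \<open>Smooth functions on a manifold, read through charts\<close>

context
  fixes A :: "('m::{t2_space, second_countable_topology}, 'e::euclidean_space) atlas"
  assumes atlas: "smooth_atlas A"
begin

text \<open>Supplies the open domain that the \<open>Ck_on\<close> lemmas require: a chart is an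
  open map onto its image, and that image is open.\<close>

lemma chart_open:
  assumes "(U, x) \<in> A" "open W"
  shows "open (x ` (U \<inter> W))"
proof -
  have "open U" and "open (x ` U)" and hom: "homeomorphism U (x ` U) x (inv_into U x)"
    using atlas assms(1) by (auto simp: smooth_atlas_def)
  have "openin (top_of_set U) (U \<inter> W)"
    using assms(2) by (simp add: openin_open_Int)
  then have "openin (top_of_set (x ` U)) (x ` (U \<inter> W))"
    using homeomorphism_imp_open_map[OF hom] by blast
  then show ?thesis
    using \<open>open (x ` U)\<close> openin_open_trans by blast
qed

lemma chart_inv:
  assumes "(U, x) \<in> A" "q \<in> U"
  shows "inv_into U x (x q) = q"
proof -
  have "homeomorphism U (x ` U) x (inv_into U x)"
    using atlas assms(1) by (auto simp: smooth_atlas_def)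
  then show ?thesis
    using assms(2) by (simp add: homeomorphism_def)
qed

lemma smooth_fun_on_subset:
  assumes "smooth_fun_on A W f" "W' \<subseteq> W"
  shows "smooth_fun_on A W' f"
  using assms unfolding smooth_fun_on_def smooth_on_def
  by (fast intro: Ck_on_subset)

lemma smooth_fun_on_cong:
  assumes "open W" "\<And>q. q \<in> W \<Longrightarrow> f q = f' q" "smooth_fun_on A W f"
  shows "smooth_fun_on A W f'"
  unfolding smooth_fun_on_def smooth_on_def
proof clarify
  fix U x k assume c: "(U, x) \<in> A"
  have "Ck_on k (x ` (U \<inter> W)) (f \<circ> inv_into U x)"
    using assms(3) c unfolding smooth_fun_on_def smooth_on_def by blast
  then show "Ck_on k (x ` (U \<inter> W)) (f' \<circ> inv_into U x)"
    by (rule Ck_on_cong[OF chart_open[OF c assms(1)], rotated]) (use assms(2) chart_inv[OF c] in auto)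
qed

lemma smooth_fun_on_local:
  assumes "\<And>p. p \<in> W \<Longrightarrow> \<exists>V. open V \<and> p \<in> V \<and> smooth_fun_on A V f"
  shows "smooth_fun_on A W f"
  unfolding smooth_fun_on_def smooth_on_def
proof clarify
  fix U x k assume c: "(U, x) \<in> A"
  show "Ck_on k (x ` (U \<inter> W)) (f \<circ> inv_into U x)"
  proof (rule Ck_on_local)
    fix y assume "y \<in> x ` (U \<inter> W)"
    then obtain p where p: "p \<in> U" "p \<in> W" "y = x p" by auto
    then obtain V where V: "open V" "p \<in> V" "smooth_fun_on A V f"
      using assms by blast
    then have "Ck_on k (x ` (U \<inter> V)) (f \<circ> inv_into U x)"
      using c unfolding smooth_fun_on_def smooth_on_def by blast
    then show "\<exists>T. open T \<and> y \<in> T \<and> Ck_on k T (f \<circ> inv_into U x)"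
      using chart_open[OF c V(1)] p V(2) by blast
  qed
qed

lemma smooth_fun_on_const: "open W \<Longrightarrow> smooth_fun_on A W (\<lambda>p. c)"
  unfolding smooth_fun_on_def smooth_on_def comp_def using chart_open by (fast intro: Ck_on_const)

lemma smooth_fun_on_add:
  assumes "open W" "smooth_fun_on A W f" "smooth_fun_on A W f'"
  shows "smooth_fun_on A W (\<lambda>p. f p + f' p)"
  using assms chart_open unfolding smooth_fun_on_def smooth_on_def comp_def
  by (fast intro!: Ck_on_add)

lemma smooth_fun_on_mult:
  assumes "open W" "smooth_fun_on A W f" "smooth_fun_on A W f'"
  shows "smooth_fun_on A W (\<lambda>p. f p * f' p)"
  using assms chart_open unfolding smooth_fun_on_def smooth_on_def comp_def
  by (fast intro!: Ck_on_mult)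

lemma smooth_fun_on_inverse:
  assumes "open W" "smooth_fun_on A W f" "\<And>p. p \<in> W \<Longrightarrow> f p \<noteq> 0"
  shows "smooth_fun_on A W (\<lambda>p. inverse (f p))"
  unfolding smooth_fun_on_def smooth_on_def comp_def
proof clarify
  fix U x k assume c: "(U, x) \<in> A"
  then show "Ck_on k (x ` (U \<inter> W)) (\<lambda>y. inverse (f (inv_into U x y)))"
    using assms chart_open[OF c] chart_inv[OF c] unfolding smooth_fun_on_def smooth_on_def comp_def
    by (intro Ck_on_inverse) auto
qed


section \<open>The module of vector fields\<close>

lemma subspace_tangent_space: "subspace (tangent_space A p)"
proof -
  have mult: "smooth_fun A (f * f')" if "smooth_fun A f" "smooth_fun A f'" for f f'
    using smooth_fun_on_mult[OF open_UNIV that] by (simp add: times_fun_def)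
  show ?thesis
  proof (rule subspaceI)
    show "0 \<in> tangent_space A p"
      by (simp add: tangent_space_def linear_map_on_def)
  next
    fix u v assume "u \<in> tangent_space A p" "v \<in> tangent_space A p"
    then show "u + v \<in> tangent_space A p"
      unfolding tangent_space_def linear_map_on_def using mult
      by (simp add: algebra_simps)
  next
    fix c v assume "v \<in> tangent_space A p"
    then show "c *\<^sub>R v \<in> tangent_space A p"
      unfolding tangent_space_def linear_map_on_def using mult
      by (simp add: scaleR_fun_def algebra_simps)
  qed
qed

lemma vector_field_on_add:
  assumes "open U" "vector_field_on A U X" "vector_field_on A U Y"
  shows "vector_field_on A U (\<lambda>p. X p + Y p)"
  unfolding vector_field_on_def
proof (intro conjI ballI allI impI)
  show "X p + Y p \<in> tangent_space A p" if "p \<in> U" for p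
    using assms(2,3) that by (simp add: vector_field_on_def subspace_add[OF subspace_tangent_space])
  show "smooth_fun_on A U (\<lambda>p. (X p + Y p) f)" if "smooth_fun A f" for f
    using smooth_fun_on_add[OF assms(1)] assms(2,3) that by (simp add: vector_field_on_def)
qed

lemma vector_field_on_scaleR:
  assumes "open U" "smooth_fun_on A U f" "vector_field_on A U X"
  shows "vector_field_on A U (\<lambda>p. f p *\<^sub>R X p)"
  unfolding vector_field_on_def
proof (intro conjI ballI allI impI)
  show "f p *\<^sub>R X p \<in> tangent_space A p" if "p \<in> U" for p
    using assms(3) that by (simp add: vector_field_on_def subspace_scale[OF subspace_tangent_space])
  show "smooth_fun_on A U (\<lambda>p. (f p *\<^sub>R X p) f')" if "smooth_fun A f'" for f'
    using smooth_fun_on_mult[OF assms(1,2)] assms(3) that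
    by (simp add: vector_field_on_def scaleR_fun_def)
qed

lemma vector_field_on_diff:
  assumes "open U" "vector_field_on A U X" "vector_field_on A U Y"
  shows "vector_field_on A U (\<lambda>p. X p - Y p)"
  using vector_field_on_add[OF assms(1,2)
      vector_field_on_scaleR[OF assms(1) smooth_fun_on_const[OF assms(1), of "-1"] assms(3)]]
  by simp

lemma vector_field_on_zero: "open U \<Longrightarrow> vector_field_on A U (\<lambda>p. 0)"
  using subspace_0[OF subspace_tangent_space] smooth_fun_on_const[of U 0]
  by (simp add: vector_field_on_def)

lemma vector_field_on_subset:
  "vector_field_on A U X \<Longrightarrow> V \<subseteq> U \<Longrightarrow> vector_field_on A V X"
  unfolding vector_field_on_def using smooth_fun_on_subset by blast

text \<open>The local representatives \<open>Y\<close> may come from unrelated constructions as long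
  as each agrees with \<open>X\<close> near its point. In this way projections computed in local
  frames yield a global smooth field.\<close>

lemma vector_field_on_local:
  assumes "\<And>p. p \<in> W \<Longrightarrow> \<exists>V Y. open V \<and> p \<in> V \<and> vector_field_on A V Y \<and> (\<forall>q\<in>V. Y q = X q)"
  shows "vector_field_on A W X"
  unfolding vector_field_on_def
proof (intro conjI ballI allI impI)
  fix p assume "p \<in> W"
  then obtain V Y where "p \<in> V" "vector_field_on A V Y" "\<forall>q\<in>V. Y q = X q"
    using assms by blast
  then show "X p \<in> tangent_space A p"
    by (auto simp: vector_field_on_def)
next
  fix f assume f: "smooth_fun A f"
  show "smooth_fun_on A W (\<lambda>p. X p f)"
  proof (rule smooth_fun_on_local)
    fix p assume "p \<in> W"
    then obtain V Y where V: "open V" "p \<in> V" "vector_field_on A V Y" "\<forall>q\<in>V. Y q = X q"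
      using assms by blast
    have "smooth_fun_on A V (\<lambda>p. Y p f)"
      using V(3) f by (simp add: vector_field_on_def)
    then have "smooth_fun_on A V (\<lambda>p. X p f)"
      using smooth_fun_on_cong[OF V(1), of "\<lambda>p. Y p f" "\<lambda>p. X p f"] V(4) by simp
    then show "\<exists>V. open V \<and> p \<in> V \<and> smooth_fun_on A V (\<lambda>p. X p f)"
      using V by blast
  qed
qed

end


section \<open>Orthogonal projections\<close>

text \<open>Everything is relative to \<open>T\<close>, because a metric \<open>g p\<close> is
  constrained only on tangent vectors and is arbitrary on other functionals.\<close>

locale inner_product_on =
  fixes T :: "'v::real_vector set" and b :: "'v \<Rightarrow> 'v \<Rightarrow> real"
  assumes T: "subspace T"
    and lin: "\<And>u. u \<in> T \<Longrightarrow> linear_map_on T (b u)"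
    and sym: "\<And>u v. u \<in> T \<Longrightarrow> v \<in> T \<Longrightarrow> b u v = b v u"
    and pos: "\<And>u. u \<in> T \<Longrightarrow> u \<noteq> 0 \<Longrightarrow> b u u > 0"
begin

lemma add_right: "u \<in> T \<Longrightarrow> v \<in> T \<Longrightarrow> w \<in> T \<Longrightarrow> b u (v + w) = b u v + b u w"
  using lin by (simp add: linear_map_on_def)

lemma scale_right: "u \<in> T \<Longrightarrow> v \<in> T \<Longrightarrow> b u (c *\<^sub>R v) = c * b u v"
  using lin by (simp add: linear_map_on_def)

lemma add_left: "u \<in> T \<Longrightarrow> v \<in> T \<Longrightarrow> w \<in> T \<Longrightarrow> b (v + w) u = b v u + b w u"
  using sym add_right subspace_add[OF T] by metis

lemma scale_left: "u \<in> T \<Longrightarrow> v \<in> T \<Longrightarrow> b (c *\<^sub>R v) u = c * b v u"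
  using sym scale_right subspace_scale[OF T] by metis

lemma diff_left: "u \<in> T \<Longrightarrow> v \<in> T \<Longrightarrow> w \<in> T \<Longrightarrow> b (v - w) u = b v u - b w u"
  using add_left[of u "v - w" w] subspace_diff[OF T, of v w] by simp

text \<open>As \<open>orth_proj\<close> is a definite description, uniqueness is the point: the
  difference of two candidates lies in \<open>W\<close> and is orthogonal to \<open>W\<close>, hence
  to itself. Existence is not claimed; the candidate \<open>u\<close> is given.\<close>

lemma orth_proj_eqI:
  assumes W: "subspace W" "W \<subseteq> T" and v: "v \<in> T"
    and u: "u \<in> W" "\<And>w. w \<in> W \<Longrightarrow> b (v - u) w = 0"
  shows "orth_proj b W v = u"
  unfolding orth_proj_def
proof (rule the_equality)
  show "u \<in> W \<and> (\<forall>w\<in>W. b (v - u) w = 0)"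
    using u by blast
next
  fix u' assume u': "u' \<in> W \<and> (\<forall>w\<in>W. b (v - u') w = 0)"
  define d where "d = u' - u"
  have d: "d \<in> W"
    unfolding d_def using u' u(1) subspace_diff[OF W(1)] by blast
  have T': "d \<in> T" "u \<in> T" "u' \<in> T"
    using d u(1) u' W(2) by auto
  have "b v d - b u d = 0" "b v d - b u' d = 0"
    using u(2)[OF d] u' d diff_left[OF T'(1) v T'(2)] diff_left[OF T'(1) v T'(3)] by auto
  then have "b d d = 0"
    using diff_left[OF T'(1) T'(3) T'(2)] unfolding d_def by linarith
  then have "d = 0"
    using pos[OF T'(1)] by fastforce
  then show "u' = u"
    by (simp add: d_def)
qed

text \<open>Given the projections \<open>y0\<close> of \<open>x\<close> and \<open>y1\<close> of
  \<open>z\<close> to \<open>S\<close>, the vector \<open>n\<close> is the new orthogonal direction,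
  and \<open>y\<close> is the projection of \<open>z\<close> to the enlarged span. Leaving
  \<open>n\<close> unnormalized avoids square roots, so the coefficient of \<open>n\<close> is built
  from products and an inverse only.\<close>

lemma gram_schmidt_step:
  assumes S: "subspace S" "S \<subseteq> T" and xz: "x \<in> T" "z \<in> T" "x \<notin> S"
    and y0: "y0 \<in> S" "\<forall>w\<in>S. b (x - y0) w = 0"
    and y1: "y1 \<in> S" "\<forall>w\<in>S. b (z - y1) w = 0"
  defines "n \<equiv> x - y0"
  defines "y \<equiv> y1 + (b z n * inverse (b n n)) *\<^sub>R n"
  shows "b n n \<noteq> 0" "y \<in> span (insert x S)" "\<forall>w\<in>span (insert x S). b (z - y) w = 0"
proof -
  have T': "y0 \<in> T" "y1 \<in> T" "n \<in> T"
    using y0 y1 S xz subspace_diff[OF T] by (auto simp: n_def)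
  have "n \<noteq> 0"
    using xz(3) y0(1) by (auto simp: n_def)
  then show nn: "b n n \<noteq> 0"
    using pos T' by fastforce
  have span: "S \<subseteq> span (insert x S)" "x \<in> span (insert x S)"
    by (auto intro: span_base)
  then have "n \<in> span (insert x S)"
    using y0(1) unfolding n_def by (auto intro: span_diff)
  then show "y \<in> span (insert x S)"
    using y1(1) span unfolding y_def by (auto intro!: span_add span_scale)
  define c where "c = b z n * inverse (b n n)"
  have eq: "b (z - y) w = b (z - y1) w - c * b n w" if "w \<in> T" for w
  proof -
    have zy: "z - y = (z - y1) - c *\<^sub>R n"
      by (simp add: y_def c_def)
    show ?thesis
      unfolding zy using that xz T' diff_left[of w "z - y1" "c *\<^sub>R n"] scale_left[of w n c]
        subspace_diff[OF T, of z y1] subspace_scale[OF T, of n c] by simp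
  qed
  have orth_n: "b n w = 0" if "w \<in> S" for w
    using y0(2) that by (simp add: n_def)
  have orth_S: "b (z - y) w = 0" if "w \<in> S" for w
    using eq[of w] orth_n[OF that] y1(2) S(2) that by auto
  \<comment> \<open>Here \<open>y1\<close> lies in \<open>S\<close>, to which \<open>n\<close> is
    orthogonal. The coefficient \<open>c\<close> is chosen so that \<open>c * b n n\<close> cancels
    \<open>b z n\<close>.\<close>
  have "b (z - y1) n = b z n"
    using diff_left[OF T'(3) xz(2) T'(2)] sym[OF T'(2,3)] orth_n[OF y1(1)] by simp
  then have orth_zn: "b (z - y) n = 0"
    using eq[OF T'(3)] nn by (simp add: c_def)
  show "\<forall>w\<in>span (insert x S). b (z - y) w = 0"
  proof
    fix w assume "w \<in> span (insert x S)"
    then obtain k where "w - k *\<^sub>R x \<in> span S"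
      using span_breakdown_eq by blast
    then have "w - k *\<^sub>R x \<in> S"
      using span_eq_iff[of S] S(1) by metis
    \<comment> \<open>Trading \<open>x\<close> for \<open>y0 + n\<close> writes \<open>w\<close> as
      an element of \<open>S\<close> plus a multiple of \<open>n\<close>; \<open>z - y\<close> is
      orthogonal to both.\<close>
    then have s: "w - k *\<^sub>R x + k *\<^sub>R y0 \<in> S" (is "?s \<in> S")
      using y0(1) S(1) by (auto intro: subspace_add subspace_scale)
    have w: "w = ?s + k *\<^sub>R n"
      by (simp add: n_def algebra_simps)
    have "z - y \<in> T"
      using xz T' unfolding y_def by (intro subspace_diff[OF T] subspace_add[OF T] subspace_scale[OF T])
    then have "b (z - y) (?s + k *\<^sub>R n) = b (z - y) ?s + k * b (z - y) n"
      using s S(2) T'(3) subspace_scale[OF T] add_right scale_right by (metis subsetD)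
    then show "b (z - y) w = 0"
      using orth_S[OF s] orth_zn w by simp
  qed
qed

end

section \<open>Smooth orthogonal projection onto a distribution\<close>

locale riemannian =
  fixes A :: "('m::{t2_space, second_countable_topology}, 'e::euclidean_space) atlas"
    and g :: "'m metric"
  assumes riemannian: "riemannian_manifold A g"
begin

lemma atlas: "smooth_atlas A"
  using riemannian by (simp add: riemannian_manifold_def)

lemma inner: "inner_product_on (tangent_space A p) (g p)"
  using riemannian subspace_tangent_space[OF atlas]
  by (auto simp: inner_product_on_def riemannian_manifold_def riemannian_metric_def)

lemma smooth_metric:
  "open U \<Longrightarrow> vector_field_on A U X \<Longrightarrow> vector_field_on A U Y \<Longrightarrow>
    smooth_fun_on A U (\<lambda>p. g p (X p) (Y p))"
  using riemannian by (auto simp: riemannian_manifold_def riemannian_metric_def)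

text \<open>Gram-Schmidt by induction on the length of the frame. \<open>Z\<close> has to be
  general, since the induction hypothesis is applied both to \<open>Z\<close> and to the last frame
  field \<open>X k\<close>.\<close>

lemma frame_projection:
  fixes k :: nat
  assumes U: "open U"
    and "\<And>i. i < k \<Longrightarrow> vector_field_on A U (X i)"
    and "\<And>q. q \<in> U \<Longrightarrow> inj_on (\<lambda>i. X i q) {..<k}"
    and "\<And>q. q \<in> U \<Longrightarrow> independent ((\<lambda>i. X i q) ` {..<k})"
    and "vector_field_on A U Z"
  shows "\<exists>Y. vector_field_on A U Y \<and> (\<forall>q\<in>U. Y q \<in> span ((\<lambda>i. X i q) ` {..<k}) \<and>
           (\<forall>w\<in>span ((\<lambda>i. X i q) ` {..<k}). g q (Z q - Y q) w = 0))"
  using assms(2-5)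
proof (induction k arbitrary: Z)
  case 0
  have "g q u 0 = 0" if "u \<in> tangent_space A q" for q u
    using inner_product_on.scale_right[OF inner that that, of 0] by simp
  moreover have "Z q \<in> tangent_space A q" if "q \<in> U" for q
    using "0.prems"(4) that by (simp add: vector_field_on_def)
  moreover define Y :: "'m vfield" where "Y = (\<lambda>p. 0)"
  ultimately have "\<forall>q\<in>U. Y q \<in> span ((\<lambda>i. X i q) ` {..<0}) \<and>
      (\<forall>w\<in>span ((\<lambda>i. X i q) ` {..<0}). g q (Z q - Y q) w = 0)"
    by simp
  then show ?case
    using vector_field_on_zero[OF atlas U] unfolding Y_def by blast
next
  case (Suc k)
  let ?S = "\<lambda>q. span ((\<lambda>i. X i q) ` {..<k})"
  \<comment> \<open>Injectivity of the indexing matters here: independence of the image set alone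
    would not notice \<open>X k q\<close> repeating an earlier frame vector.\<close>
  have indep: "X k q \<notin> ?S q" "inj_on (\<lambda>i. X i q) {..<k}" "independent ((\<lambda>i. X i q) ` {..<k})"
    if "q \<in> U" for q
  proof -
    have inj: "inj_on (\<lambda>i. X i q) (insert k {..<k})"
      and ind: "independent (insert (X k q) ((\<lambda>i. X i q) ` {..<k}))"
      using Suc.prems(2,3)[OF that] by (simp_all add: lessThan_Suc)
    then show "inj_on (\<lambda>i. X i q) {..<k}" "independent ((\<lambda>i. X i q) ` {..<k})"
      using inj_on_subset[OF inj] independent_mono[OF ind] by auto
    have "X k q \<notin> (\<lambda>i. X i q) ` {..<k}"
      using inj by auto
    then show "X k q \<notin> ?S q"
      using ind by (simp add: independent_insert)
  qed
  have Xk: "vector_field_on A U (X k)"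
    using Suc.prems(1) by simp
  have IH: "\<exists>Y. vector_field_on A U Y \<and> (\<forall>q\<in>U. Y q \<in> ?S q \<and> (\<forall>w\<in>?S q. g q (Z q - Y q) w = 0))"
    if "vector_field_on A U Z" for Z
    by (rule Suc.IH[OF _ _ _ that]) (use Suc.prems(1) indep in auto)
  obtain Y0 where Y0: "vector_field_on A U Y0"
    "\<And>q. q \<in> U \<Longrightarrow> Y0 q \<in> ?S q" "\<And>q. q \<in> U \<Longrightarrow> \<forall>w\<in>?S q. g q (X k q - Y0 q) w = 0"
    using IH[OF Xk] by blast
  obtain Y1 where Y1: "vector_field_on A U Y1"
    "\<And>q. q \<in> U \<Longrightarrow> Y1 q \<in> ?S q" "\<And>q. q \<in> U \<Longrightarrow> \<forall>w\<in>?S q. g q (Z q - Y1 q) w = 0"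
    using IH[OF Suc.prems(4)] by blast
  define N where "N = (\<lambda>q. X k q - Y0 q)"
  define Y where "Y = (\<lambda>q. Y1 q + (g q (Z q) (N q) * inverse (g q (N q) (N q))) *\<^sub>R N q)"
  have N: "vector_field_on A U N"
    unfolding N_def by (rule vector_field_on_diff[OF atlas U Xk Y0(1)])
  have step: "g q (N q) (N q) \<noteq> 0 \<and> Y q \<in> span (insert (X k q) (?S q)) \<and>
      (\<forall>w\<in>span (insert (X k q) (?S q)). g q (Z q - Y q) w = 0)" if q: "q \<in> U" for q
  proof -
    have "(\<lambda>i. X i q) ` {..<k} \<subseteq> tangent_space A q"
      using Suc.prems(1) q by (auto simp: vector_field_on_def)
    then have S: "?S q \<subseteq> tangent_space A q"
      by (rule span_minimal[OF _ subspace_tangent_space[OF atlas]])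
    have "X k q \<in> tangent_space A q" "Z q \<in> tangent_space A q"
      using Xk Suc.prems(4) q by (auto simp: vector_field_on_def)
    note inner_product_on.gram_schmidt_step[OF inner subspace_span S this indep(1)[OF q]
        Y0(2,3)[OF q] Y1(2,3)[OF q]]
    then show ?thesis
      unfolding Y_def N_def by blast
  qed
  \<comment> \<open>The inverse in the coefficient is smooth because \<open>step\<close> shows that
    \<open>g q (N q) (N q)\<close> never vanishes on \<open>U\<close>.\<close>
  have Y: "vector_field_on A U Y"
    unfolding Y_def
    by (intro vector_field_on_add[OF atlas U Y1(1)] vector_field_on_scaleR[OF atlas U _ N]
        smooth_fun_on_mult[OF atlas U] smooth_fun_on_inverse[OF atlas U]
        smooth_metric[OF U] N Suc.prems(4))
      (use step in simp)
  have "span (insert (X k q) (?S q)) = span ((\<lambda>i. X i q) ` {..<Suc k})" for q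
    by (simp add: lessThan_Suc span_insert span_span)
  then have "\<forall>q\<in>U. Y q \<in> span ((\<lambda>i. X i q) ` {..<Suc k}) \<and>
      (\<forall>w\<in>span ((\<lambda>i. X i q) ` {..<Suc k}). g q (Z q - Y q) w = 0)"
    using step by metis
  then show ?case
    using Y by blast
qed

text \<open>By uniqueness of projections, the field that a local frame produces equals
  \<open>orth_proj\<close> whatever frame is chosen, so the local fields patch together.
  Orthogonality is recorded as well: it is the existence half, which the definite description does
  not give by itself.\<close>

lemma smooth_distribution_projection:
  assumes "smooth_distribution A D" and DT: "\<And>p. D p \<subseteq> tangent_space A p"
    and Z: "vector_field A Z"
  shows "section_of A D (\<lambda>p. orth_proj (g p) (D p) (Z p))"
    and "w \<in> D p \<Longrightarrow> g p (Z p - orth_proj (g p) (D p) (Z p)) w = 0"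
proof -
  have main: "\<exists>U Y. open U \<and> p \<in> U \<and> vector_field_on A U Y \<and> (\<forall>q\<in>U. Y q \<in> D q \<and>
    Y q = orth_proj (g q) (D q) (Z q) \<and> (\<forall>w\<in>D q. g q (Z q - Y q) w = 0))" for p
  proof -
    obtain k :: nat and U X where U: "open U" "p \<in> U"
      and "(\<forall>i<k. vector_field_on A U (X i)) \<and>
        (\<forall>q\<in>U. inj_on (\<lambda>i. X i q) {..<k} \<and>
           independent ((\<lambda>i. X i q) ` {..<k}) \<and> span ((\<lambda>i. X i q) ` {..<k}) = D q)"
      using assms(1) unfolding smooth_distribution_def by blast
    then have X: "\<And>i. i < k \<Longrightarrow> vector_field_on A U (X i)"
      and q: "\<And>q. q \<in> U \<Longrightarrow> inj_on (\<lambda>i. X i q) {..<k}"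
      "\<And>q. q \<in> U \<Longrightarrow> independent ((\<lambda>i. X i q) ` {..<k})"
      "\<And>q. q \<in> U \<Longrightarrow> span ((\<lambda>i. X i q) ` {..<k}) = D q"
      by simp_all
    have "vector_field_on A U Z"
      using vector_field_on_subset[OF atlas Z] by simp
    from frame_projection[OF U(1) X q(1,2) this]
    obtain Y where Y: "vector_field_on A U Y"
      "\<And>q. q \<in> U \<Longrightarrow> Y q \<in> D q" "\<And>q w. q \<in> U \<Longrightarrow> w \<in> D q \<Longrightarrow> g q (Z q - Y q) w = 0"
      using q(3) by auto
    have "Y q = orth_proj (g q) (D q) (Z q)" if "q \<in> U" for q
    proof (rule inner_product_on.orth_proj_eqI[OF inner, symmetric])
      show "subspace (D q)"
        unfolding q(3)[OF that, symmetric] by (rule subspace_span)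
      show "Z q \<in> tangent_space A q"
        using Z by (simp add: vector_field_on_def)
    qed (rule DT Y(2,3) that | assumption)+
    then show ?thesis
      using U Y by blast
  qed
  have "vector_field A (\<lambda>p. orth_proj (g p) (D p) (Z p))"
  proof (rule vector_field_on_local[OF atlas])
    fix p
    show "\<exists>V Y. open V \<and> p \<in> V \<and> vector_field_on A V Y \<and> (\<forall>q\<in>V. Y q = orth_proj (g q) (D q) (Z q))"
      using main[of p] by blast
  qed
  moreover have pointwise: "orth_proj (g p) (D p) (Z p) \<in> D p \<and>
    (\<forall>w\<in>D p. g p (Z p - orth_proj (g p) (D p) (Z p)) w = 0)" for p
  proof -
    obtain Y where "Y p \<in> D p" "Y p = orth_proj (g p) (D p) (Z p)"
        "\<forall>w\<in>D p. g p (Z p - Y p) w = 0"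
      using main[of p] by blast
    then show ?thesis
      by metis
  qed
  ultimately show "section_of A D (\<lambda>p. orth_proj (g p) (D p) (Z p))"
    by (simp add: section_of_def)
  show "w \<in> D p \<Longrightarrow> g p (Z p - orth_proj (g p) (D p) (Z p)) w = 0"
    using pointwise by blast
qed

end


section \<open>Vertical and horizontal parts of vector fields\<close>

lemma levi_civita_vector_field:
  assumes "levi_civita A g nabla" "vector_field A X" "vector_field A Y"
  shows "vector_field A (nabla X Y)"
  by (rule assms(1)[unfolded levi_civita_def, THEN conjunct1, rule_format, OF conjI])
    (rule assms)+

lemma levi_civita_add_right:
  assumes "levi_civita A g nabla" "vector_field A X" "vector_field A Y" "vector_field A Y'"
  shows "nabla X (Y + Y') = nabla X Y + nabla X Y'"
  by (rule assms(1)[unfolded levi_civita_def, THEN conjunct2, THEN conjunct2, THEN conjunct2,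
        THEN conjunct1, rule_format, OF conjI[OF _ conjI]])
    (rule assms)+

text \<open>Smooth local frames are supplied for \<open>D1\<close> and \<open>D2\<close> separately.
  Smoothness of the vertical projection is obtained from them through the orthogonal sum.\<close>

locale vertical_splitting = riemannian A g
  for A :: "('m::{t2_space, second_countable_topology}, 'e::euclidean_space) atlas"
    and g :: "'m metric" +
  fixes B :: "('n::{t2_space, second_countable_topology}, 'f::euclidean_space) atlas"
    and F :: "'m \<Rightarrow> 'n" and D1 D2 :: "'m distrib"
  assumes smooth_D: "smooth_distribution A D1" "smooth_distribution A D2"
    and vertical_eq: "\<And>p. vertical A B F p = {u + v |u v. u \<in> D1 p \<and> v \<in> D2 p}"
    and orth_D: "\<And>p u v. u \<in> D1 p \<Longrightarrow> v \<in> D2 p \<Longrightarrow> g p u v = 0"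
begin

abbreviation "Ver \<equiv> vertical A B F"
abbreviation "Hor \<equiv> horizontal A g B F"
abbreviation "\<V> \<equiv> ver_proj A g B F"
abbreviation "\<H> \<equiv> hor_proj A g B F"

section \<open>Linear algebra of the vertical and horizontal spaces at a point\<close>

lemma subspace_distribution:
  assumes "smooth_distribution A D"
  shows "subspace (D p)"
proof -
  obtain S where "D p = span S"
    using assms unfolding smooth_distribution_def by metis
  then show ?thesis
    by (simp only: subspace_span)
qed

lemma subspace_vertical: "subspace (Ver p)"
  unfolding vertical_eq
  by (intro subspace_sums subspace_distribution smooth_D)

lemma vertical_subset: "Ver p \<subseteq> tangent_space A p"
  by (auto simp: vertical_def)

lemma horizontal_subset: "Hor p \<subseteq> tangent_space A p"
  by (auto simp: horizontal_def)

lemma D_subset: "D1 p \<subseteq> Ver p" "D2 p \<subseteq> Ver p"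
proof -
  have 0: "0 \<in> D1 p" "0 \<in> D2 p"
    using subspace_0 subspace_distribution smooth_D by blast+
  show "D1 p \<subseteq> Ver p"
  proof
    fix u assume "u \<in> D1 p"
    then have "u + 0 \<in> Ver p" unfolding vertical_eq using 0 by blast
    then show "u \<in> Ver p" by (simp only: add_0_right)
  qed
  show "D2 p \<subseteq> Ver p"
  proof
    fix u assume "u \<in> D2 p"
    then have "0 + u \<in> Ver p" unfolding vertical_eq using 0 by blast
    then show "u \<in> Ver p" by (simp only: add_0_left)
  qed
qed

lemma horizontal_orth: "u \<in> Hor p \<Longrightarrow> w \<in> Ver p \<Longrightarrow> g p u w = 0"
  by (simp add: horizontal_def)

lemma vertical_orth: "u \<in> Ver p \<Longrightarrow> w \<in> Hor p \<Longrightarrow> g p u w = 0"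
  using inner_product_on.sym[OF inner] horizontal_orth vertical_subset horizontal_subset
  by (metis subsetD)

lemma subspace_horizontal: "subspace (Hor p)"
proof (rule subspaceI)
  interpret inner_product_on "tangent_space A p" "g p" by (rule inner)
  have w: "w \<in> tangent_space A p" if "w \<in> Ver p" for w
    using that vertical_subset by blast
  have 0: "0 \<in> tangent_space A p"
    by (rule subspace_0[OF T])
  have "g p 0 w = 0" if "w \<in> tangent_space A p" for w
    using scale_left[OF that 0, of 0] by (simp only: scaleR_zero_left mult_zero_left)
  then show "0 \<in> Hor p"
    using 0 w unfolding horizontal_def by blast
  show "u + v \<in> Hor p" if "u \<in> Hor p" "v \<in> Hor p" for u v
    using that w subspace_add[OF T, of u v] add_left[of _ u v] by (simp add: horizontal_def)
  show "c *\<^sub>R v \<in> Hor p" if "v \<in> Hor p" for c v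
    using that w subspace_scale[OF T, of v c] scale_left[of _ v c] by (simp add: horizontal_def)
qed

text \<open>Together with its horizontal counterpart, this reduces computing a projection to
  exhibiting a decomposition into a vertical and a horizontal vector.\<close>

lemma ver_proj_eqI: "v \<in> tangent_space A p \<Longrightarrow> u \<in> Ver p \<Longrightarrow> v - u \<in> Hor p \<Longrightarrow> \<V> p v = u"
  unfolding ver_proj_def
  by (rule inner_product_on.orth_proj_eqI[OF inner subspace_vertical vertical_subset])
    (auto intro: horizontal_orth)

lemma hor_proj_eqI: "v \<in> tangent_space A p \<Longrightarrow> u \<in> Hor p \<Longrightarrow> v - u \<in> Ver p \<Longrightarrow> \<H> p v = u"
  unfolding hor_proj_def
  by (rule inner_product_on.orth_proj_eqI[OF inner subspace_horizontal horizontal_subset])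
    (auto intro: vertical_orth)

lemma ver_proj_vertical: "v \<in> Ver p \<Longrightarrow> \<V> p v = v"
  using vertical_subset subspace_0[OF subspace_horizontal] by (intro ver_proj_eqI) auto

lemma ver_proj_horizontal: "v \<in> Hor p \<Longrightarrow> \<V> p v = 0"
  using horizontal_subset subspace_0[OF subspace_vertical] by (intro ver_proj_eqI) auto

lemma hor_proj_horizontal: "v \<in> Hor p \<Longrightarrow> \<H> p v = v"
  using horizontal_subset subspace_0[OF subspace_vertical] by (intro hor_proj_eqI) auto

lemma hor_proj_vertical: "v \<in> Ver p \<Longrightarrow> \<H> p v = 0"
  using vertical_subset subspace_0[OF subspace_horizontal] by (intro hor_proj_eqI) auto

text \<open>Since \<open>D1\<close> and \<open>D2\<close> are orthogonal with sum
  \<open>Ver\<close>, adding the projections to each gives the vertical projection, and both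
  summands are smooth. The existence of the vertical-horizontal decomposition is established here
  too.\<close>

lemma vector_field_splitting:
  assumes X: "vector_field A X"
  shows "section_of A Ver (\<V> \<diamondop> X)" "section_of A Hor (\<H> \<diamondop> X)" "\<V> \<diamondop> X + \<H> \<diamondop> X = X"
proof -
  define Y1 where "Y1 = (\<lambda>p. orth_proj (g p) (D1 p) (X p))"
  define Y2 where "Y2 = (\<lambda>p. orth_proj (g p) (D2 p) (X p))"
  have DT: "D1 p \<subseteq> tangent_space A p" "D2 p \<subseteq> tangent_space A p" for p
    using D_subset vertical_subset by blast+
  have Y1: "vector_field A Y1" "Y1 p \<in> D1 p" "w \<in> D1 p \<Longrightarrow> g p (X p - Y1 p) w = 0"
    and Y2: "vector_field A Y2" "Y2 p \<in> D2 p" "w \<in> D2 p \<Longrightarrow> g p (X p - Y2 p) w = 0" for p w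
    using smooth_distribution_projection[OF smooth_D(1) DT(1) X]
      smooth_distribution_projection[OF smooth_D(2) DT(2) X]
    unfolding section_of_def Y1_def Y2_def by blast+
  define Y where "Y = (\<lambda>p. Y1 p + Y2 p)"
  have Y: "vector_field A Y"
    unfolding Y_def by (rule vector_field_on_add[OF atlas open_UNIV Y1(1) Y2(1)])
  have Yv: "Y p \<in> Ver p" for p
    unfolding Y_def vertical_eq using Y1(2) Y2(2) by blast
  have XT: "X p \<in> tangent_space A p" for p
    using X by (simp add: vector_field_on_def)
  have XY: "X p - Y p \<in> Hor p" for p
  proof -
    interpret inner_product_on "tangent_space A p" "g p" by (rule inner)
    have T': "Y1 p \<in> tangent_space A p" "Y2 p \<in> tangent_space A p"
      using Y1(2) Y2(2) DT by blast+
    have "g p (X p - Y p) w = 0" if w: "w \<in> Ver p" for w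
    proof -
      obtain u v where uv: "w = u + v" "u \<in> D1 p" "v \<in> D2 p"
        using w unfolding vertical_eq by blast
      have uvT: "u \<in> tangent_space A p" "v \<in> tangent_space A p"
        using uv DT by blast+
      \<comment> \<open>Against \<open>u\<close> in \<open>D1\<close>, the remainder
        \<open>X p - Y1 p\<close> contributes nothing by the projection property, and
        \<open>Y2 p\<close> nothing by orthogonality of \<open>D1\<close> and \<open>D2\<close>. The
        case of \<open>v\<close> is symmetric.\<close>
      have "g p (X p - Y p) u = g p (X p - Y1 p) u - g p u (Y2 p)"
        unfolding Y_def diff_diff_eq[symmetric]
        using diff_left[OF uvT(1) subspace_diff[OF T XT T'(1)] T'(2)] sym[OF T'(2) uvT(1)] by argo
      moreover have "g p (X p - Y p) v = g p (X p - Y2 p) v - g p (Y1 p) v"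
        unfolding Y_def add.commute[of "Y1 p"] diff_diff_eq[symmetric]
        using diff_left[OF uvT(2) subspace_diff[OF T XT T'(2)] T'(1)] by argo
      moreover have "g p (X p - Y p) (u + v) = g p (X p - Y p) u + g p (X p - Y p) v"
        using add_right[OF subspace_diff[OF T XT] uvT] Yv vertical_subset by blast
      ultimately show ?thesis
        using uv(1) Y1(3)[OF uv(2)] Y2(3)[OF uv(3)] orth_D[OF uv(2) Y2(2)] orth_D[OF Y1(2) uv(3)]
        by simp
    qed
    moreover have "X p - Y p \<in> tangent_space A p"
      using subspace_diff[OF T XT] Yv vertical_subset by blast
    ultimately show ?thesis
      by (simp add: horizontal_def)
  qed
  have V: "\<V> \<diamondop> X = Y"
    unfolding apply_endo_def by (rule ext) (rule ver_proj_eqI[OF XT Yv XY])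
  have H: "\<H> \<diamondop> X = (\<lambda>p. X p - Y p)"
    unfolding apply_endo_def
  proof (rule ext, rule hor_proj_eqI[OF XT XY])
    show "X p - (X p - Y p) \<in> Ver p" for p
      using Yv[of p] by (simp only: diff_diff_eq2 add_diff_cancel_left')
  qed
  show "section_of A Ver (\<V> \<diamondop> X)"
    unfolding V section_of_def using Y Yv by blast
  show "section_of A Hor (\<H> \<diamondop> X)"
    unfolding H section_of_def using vector_field_on_diff[OF atlas open_UNIV X Y] XY by blast
  show "\<V> \<diamondop> X + \<H> \<diamondop> X = X"
    unfolding V H by (rule ext) (simp only: plus_fun_apply add_diff_eq add_diff_cancel_left')
qed

text \<open>Pointwise form, for values of global vector fields, because the decomposition was
  constructed for fields.\<close>

lemma vector_field_splitting_at:
  assumes "vector_field A X"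
  shows "\<V> p (X p) \<in> Ver p" "\<H> p (X p) \<in> Hor p" "X p = \<V> p (X p) + \<H> p (X p)"
proof -
  note split = vector_field_splitting[OF assms]
  show "\<V> p (X p) \<in> Ver p" "\<H> p (X p) \<in> Hor p"
    using split(1,2) by (simp_all add: section_of_def apply_endo_def)
  show "X p = \<V> p (X p) + \<H> p (X p)"
    using fun_cong[OF split(3), of p] by (simp only: plus_fun_apply apply_endo_def)
qed

text \<open>Adding the decompositions of \<open>X\<close> and \<open>Y\<close> decomposes
  \<open>X + Y\<close>, and decompositions are unique.\<close>

lemma proj_add:
  assumes X: "vector_field A X" and Y: "vector_field A Y"
  shows "\<V> \<diamondop> (X + Y) = \<V> \<diamondop> X + \<V> \<diamondop> Y" "\<H> \<diamondop> (X + Y) = \<H> \<diamondop> X + \<H> \<diamondop> Y"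
proof -
  note X' = vector_field_splitting_at[OF X] and Y' = vector_field_splitting_at[OF Y]
  have T: "X p + Y p \<in> tangent_space A p" for p
    using X Y subspace_add[OF subspace_tangent_space[OF atlas]] by (simp add: vector_field_on_def)
  note v = subspace_add[OF subspace_vertical X'(1) Y'(1)]
    and h = subspace_add[OF subspace_horizontal X'(2) Y'(2)]
  have sum: "X p + Y p = (\<V> p (X p) + \<V> p (Y p)) + (\<H> p (X p) + \<H> p (Y p))" for p
    using arg_cong2[OF X'(3) Y'(3), of "(+)" p p] by (simp only: ac_simps)
  have "\<V> p (X p + Y p) = \<V> p (X p) + \<V> p (Y p)" for p
    by (rule ver_proj_eqI[OF T v]) (subst sum, simp only: add_diff_cancel_left' h)
  moreover have "\<H> p (X p + Y p) = \<H> p (X p) + \<H> p (Y p)" for p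
    by (rule hor_proj_eqI[OF T h]) (subst sum, simp only: add_diff_cancel_right' v)
  ultimately show "\<V> \<diamondop> (X + Y) = \<V> \<diamondop> X + \<V> \<diamondop> Y" "\<H> \<diamondop> (X + Y) = \<H> \<diamondop> X + \<H> \<diamondop> Y"
    by (simp_all only: fun_eq_iff[of _ "_ + _"] apply_endo_def plus_fun_apply simp_thms)
qed

lemma ver_proj_uminus:
  assumes X: "vector_field A X"
  shows "\<V> \<diamondop> (- X) = - (\<V> \<diamondop> X)"
proof
  fix p
  note split = vector_field_splitting_at[OF X, of p]
  have "\<V> p (- X p) = - \<V> p (X p)"
  proof (rule ver_proj_eqI)
    show "- X p \<in> tangent_space A p"
      using X subspace_neg[OF subspace_tangent_space[OF atlas]] by (simp add: vector_field_on_def)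
    show "- \<V> p (X p) \<in> Ver p"
      by (rule subspace_neg[OF subspace_vertical split(1)])
    have "- X p - - \<V> p (X p) = - \<H> p (X p)"
      by (subst split(3)) (simp only: minus_add_distrib minus_diff_minus add_diff_cancel_left')
    then show "- X p - - \<V> p (X p) \<in> Hor p"
      using subspace_neg[OF subspace_horizontal split(2)] by (simp only:)
  qed
  then show "(\<V> \<diamondop> (- X)) p = (- (\<V> \<diamondop> X)) p"
    by (simp only: apply_endo_def uminus_apply)
qed

text \<open>The heart of the proof: it identifies the expression in the criterion for each pair of
  horizontal fields, so that only the vertical part of \<open>nabla \<xi> \<eta>\<close> remains to
  be discussed.\<close>

lemma minus_vertical_part_nabla:
  assumes K: "kaehler_manifold A g J nabla"
    and \<xi>: "section_of A Hor \<xi>" and \<eta>: "section_of A Hor \<eta>"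
  defines "\<phi> \<equiv> phi_part A g J B F" and "\<omega> \<equiv> omega_part A g J B F" and "P \<equiv> P_part A g J B F"
    and "\<A> \<equiv> oneill_A A g nabla B F"
  shows "\<phi> \<diamondop> (\<A> \<xi> (\<phi> \<diamondop> \<eta>) + \<H> \<diamondop> nabla \<xi> (\<omega> \<diamondop> \<eta>)) +
      P \<diamondop> (\<A> \<xi> (\<omega> \<diamondop> \<eta>) + \<V> \<diamondop> nabla \<xi> (\<phi> \<diamondop> \<eta>)) = - (\<V> \<diamondop> nabla \<xi> \<eta>)"
proof -
  have vf: "vector_field A \<xi>" "vector_field A \<eta>"
    using \<xi> \<eta> by (auto simp: section_of_def)
  have J_vf: "vector_field A (J \<diamondop> X)" if "vector_field A X" for X
    using K that by (auto simp: kaehler_manifold_def smooth_endo_def)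
  have J_add: "J \<diamondop> (X + Y) = J \<diamondop> X + J \<diamondop> Y" if "vector_field A X" "vector_field A Y" for X Y
  proof
    fix p
    have "linear_map_on (tangent_space A p) (J p)"
      using K by (simp add: kaehler_manifold_def smooth_endo_def)
    moreover have "X p \<in> tangent_space A p" "Y p \<in> tangent_space A p"
      using that by (simp_all add: vector_field_on_def)
    ultimately show "(J \<diamondop> (X + Y)) p = (J \<diamondop> X + J \<diamondop> Y) p"
      unfolding apply_endo_def plus_fun_apply linear_map_on_def by blast
  qed
  have J_sq: "J \<diamondop> J \<diamondop> X = - X" if "vector_field A X" for X
  proof
    fix p
    have "X p \<in> tangent_space A p"
      using that by (simp add: vector_field_on_def)
    then have "J p (J p (X p)) = - X p"
      using K by (simp add: kaehler_manifold_def)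
    then show "(J \<diamondop> J \<diamondop> X) p = (- X) p"
      by (simp only: apply_endo_def uminus_apply)
  qed
  have LC: "levi_civita A g nabla"
    using K by (simp add: kaehler_manifold_def)
  note nabla_vf = levi_civita_vector_field[OF LC] and nabla_add = levi_civita_add_right[OF LC]
  have nabla_J: "nabla X (J \<diamondop> Y) = J \<diamondop> nabla X Y" if "vector_field A X" "vector_field A Y" for X Y
    using K that by (simp add: kaehler_manifold_def)
  have zero_vf: "vector_field A 0"
    using vector_field_on_zero[OF atlas open_UNIV] by (simp only: zero_fun_def[symmetric])
  \<comment> \<open>\<open>oneill_A\<close> differentiates both parts of its second argument. For a
    vertical or horizontal argument one part is the zero field, whose derivative vanishes by
    additivity.\<close>
  have nabla_0: "nabla X 0 = 0" if "vector_field A X" for X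
    using nabla_add[OF that zero_vf zero_vf] by (simp only: add_0_left add_cancel_right_right)
  have proj_0: "\<V> \<diamondop> 0 = 0" "\<H> \<diamondop> 0 = 0"
    using ver_proj_vertical[OF subspace_0[OF subspace_vertical]]
      hor_proj_horizontal[OF subspace_0[OF subspace_horizontal]]
    by (auto simp only: apply_endo_def zero_fun_apply intro!: ext)
  have fixed: "\<V> \<diamondop> X = X" "\<H> \<diamondop> X = 0" if "section_of A Ver X" for X
    using that ver_proj_vertical hor_proj_vertical
    by (auto simp only: section_of_def apply_endo_def zero_fun_apply intro!: ext)
  have fixed': "\<H> \<diamondop> X = X" "\<V> \<diamondop> X = 0" if "section_of A Hor X" for X
    using that hor_proj_horizontal ver_proj_horizontal
    by (auto simp only: section_of_def apply_endo_def zero_fun_apply intro!: ext)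
  have parts: "\<phi> \<diamondop> X = \<V> \<diamondop> J \<diamondop> X" "P \<diamondop> X = \<V> \<diamondop> J \<diamondop> X" "\<omega> \<diamondop> X = \<H> \<diamondop> J \<diamondop> X" for X
    by (simp_all only: \<phi>_def P_def \<omega>_def phi_part_def P_part_def omega_part_def apply_endo_def)
  note J\<eta> = J_vf[OF vf(2)]
  note split = vector_field_splitting[OF J\<eta>]
  define N1 where "N1 = nabla \<xi> (\<phi> \<diamondop> \<eta>)"
  define N2 where "N2 = nabla \<xi> (\<omega> \<diamondop> \<eta>)"
  have \<phi>\<eta>: "section_of A Ver (\<phi> \<diamondop> \<eta>)" and \<omega>\<eta>: "section_of A Hor (\<omega> \<diamondop> \<eta>)"
    using split(1,2) by (simp_all only: parts)
  then have N: "vector_field A N1" "vector_field A N2"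
    unfolding N1_def N2_def section_of_def using nabla_vf[OF vf(1)] by blast+
  \<comment> \<open>The fields \<open>\<phi> \<diamondop> \<eta>\<close> and
    \<open>\<omega> \<diamondop> \<eta>\<close> add up to \<open>J \<diamondop> \<eta>\<close>, and
    \<open>J\<close> is parallel.\<close>
  have N12: "N1 + N2 = J \<diamondop> nabla \<xi> \<eta>"
    using nabla_add[OF vf(1), of "\<phi> \<diamondop> \<eta>" "\<omega> \<diamondop> \<eta>"] \<phi>\<eta> \<omega>\<eta> nabla_J[OF vf] split(3)
    unfolding N1_def N2_def section_of_def parts by metis
  \<comment> \<open>With a horizontal first argument, O'Neill's tensor takes the horizontal part of
    the derivative of a vertical field and, in \<open>A2\<close>, the vertical part of the
    derivative of a horizontal one.\<close>
  have A1: "\<A> \<xi> (\<phi> \<diamondop> \<eta>) = \<H> \<diamondop> N1"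
    unfolding \<A>_def oneill_A_def Let_def fixed'(1)[OF \<xi>] fixed[OF \<phi>\<eta>] nabla_0[OF vf(1)] proj_0
    by (simp only: add_0_left N1_def)
  have A2: "\<A> \<xi> (\<omega> \<diamondop> \<eta>) = \<V> \<diamondop> N2"
    unfolding \<A>_def oneill_A_def Let_def fixed'(1)[OF \<xi>] fixed'[OF \<omega>\<eta>] nabla_0[OF vf(1)] proj_0
    by (simp only: add_0_right N2_def)
  define W where "W = J \<diamondop> nabla \<xi> \<eta>"
  note NN = nabla_vf[OF vf]
  have W: "vector_field A W"
    unfolding W_def by (rule J_vf[OF NN])
  note splitW = vector_field_splitting[OF W]
  have W': "vector_field A (\<V> \<diamondop> W)" "vector_field A (\<H> \<diamondop> W)"
    using splitW(1,2) by (simp_all only: section_of_def)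
  \<comment> \<open>The first bracket now collects the horizontal parts of \<open>N1\<close> and
    \<open>N2\<close>, the second their vertical parts. Both are then hit by the same map,
    \<open>J\<close> followed by \<open>\<V>\<close>, so the two halves of \<open>W\<close>
    recombine.\<close>
  have "\<phi> \<diamondop> (\<A> \<xi> (\<phi> \<diamondop> \<eta>) + \<H> \<diamondop> N2) + P \<diamondop> (\<A> \<xi> (\<omega> \<diamondop> \<eta>) + \<V> \<diamondop> N1) =
      \<V> \<diamondop> J \<diamondop> (\<H> \<diamondop> N1 + \<H> \<diamondop> N2) + \<V> \<diamondop> J \<diamondop> (\<V> \<diamondop> N1 + \<V> \<diamondop> N2)"
    unfolding A1 A2 by (simp only: parts add.commute)
  also have "\<dots> = \<V> \<diamondop> J \<diamondop> (\<H> \<diamondop> W) + \<V> \<diamondop> J \<diamondop> (\<V> \<diamondop> W)"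
    by (simp only: proj_add[OF N, symmetric] N12 W_def)
  also have "\<dots> = \<V> \<diamondop> (J \<diamondop> \<V> \<diamondop> W + J \<diamondop> \<H> \<diamondop> W)"
    unfolding proj_add(1)[OF J_vf[OF W'(1)] J_vf[OF W'(2)]] by (rule add.commute)
  also have "\<dots> = \<V> \<diamondop> J \<diamondop> J \<diamondop> nabla \<xi> \<eta>"
    by (simp only: J_add[OF W', symmetric] splitW(3)) (simp only: W_def)
  also have "\<dots> = - (\<V> \<diamondop> nabla \<xi> \<eta>)"
    by (simp only: J_sq[OF NN] ver_proj_uminus[OF NN])
  finally show ?thesis
    by (simp only: N1_def N2_def)
qed

text \<open>Turns the foliation condition, a membership in \<open>Hor\<close>, into an equation
  between fields of the kind that the criterion states.\<close>

lemma ver_proj_eq_0_iff: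
  assumes X: "vector_field A X"
  shows "\<V> \<diamondop> X = 0 \<longleftrightarrow> section_of A Hor X"
proof
  assume 0: "\<V> \<diamondop> X = 0"
  have "X = \<H> \<diamondop> X"
    using vector_field_splitting(3)[OF X] unfolding 0 by (simp only: add_0_left)
  then show "section_of A Hor X"
    using vector_field_splitting(2)[OF X] by metis
next
  assume "section_of A Hor X"
  then show "\<V> \<diamondop> X = 0"
    using ver_proj_horizontal by (auto simp only: section_of_def apply_endo_def zero_fun_apply intro!: ext)
qed

end

theorem theorem3p13:
  fixes A :: "('m::{t2_space, second_countable_topology}, 'e::euclidean_space) atlas"
    and g :: "'m metric" and J :: "'m endo" and nabla :: "'m conn"
    and B :: "('n::{t2_space, second_countable_topology}, 'f::euclidean_space) atlas"
    and h :: "'n metric" and \<pi> :: "'m \<Rightarrow> 'n"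
    and D1 D2 :: "'m distrib" and \<theta>1 \<theta>2 :: real
  assumes "kaehler_manifold A g J nabla"
    and "riemannian_manifold B h"
    and "proper_bi_slant_submersion A g J B h \<pi> D1 D2 \<theta>1 \<theta>2"
  shows "totally_geodesic_foliation A nabla (horizontal A g B \<pi>) \<longleftrightarrow>
    (\<forall>\<xi> \<eta>. section_of A (horizontal A g B \<pi>) \<xi> \<and> section_of A (horizontal A g B \<pi>) \<eta> \<longrightarrow>
      (let \<V> = ver_proj A g B \<pi>; \<H> = hor_proj A g B \<pi>; \<A> = oneill_A A g nabla B \<pi>;
           P = P_part A g J B \<pi>; \<phi> = phi_part A g J B \<pi>; \<omega> = omega_part A g J B \<pi>
       in \<phi> \<diamondop> (\<A> \<xi> (\<phi> \<diamondop> \<eta>) + \<H> \<diamondop> nabla \<xi> (\<omega> \<diamondop> \<eta>)) +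
          P \<diamondop> (\<A> \<xi> (\<omega> \<diamondop> \<eta>) + \<V> \<diamondop> nabla \<xi> (\<phi> \<diamondop> \<eta>)) = 0))"
proof -
  have K: "riemannian_manifold A g" and LC: "levi_civita A g nabla"
    using assms(1) by (simp_all add: kaehler_manifold_def)
  have "bi_slant_submersion A g J B h \<pi> D1 D2 \<theta>1 \<theta>2"
    using assms(3) by (simp add: proper_bi_slant_submersion_def)
  \<comment> \<open>The bi-slant decomposition provides the smooth orthogonal splitting of the
    vertical spaces.\<close>
  then interpret vertical_splitting A g B \<pi> D1 D2
    using K by unfold_locales (auto simp: bi_slant_submersion_def)
  \<comment> \<open>The equivalence already holds for each pair of fields separately. The sign is
    kept to match the right-hand side of \<open>minus_vertical_part_nabla\<close>.\<close>
  have key: "section_of A Hor (nabla \<xi> \<eta>) \<longleftrightarrow> - (\<V> \<diamondop> nabla \<xi> \<eta>) = 0"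
    if "section_of A Hor \<xi>" "section_of A Hor \<eta>" for \<xi> \<eta>
  proof -
    have "vector_field A (nabla \<xi> \<eta>)"
      using levi_civita_vector_field[OF LC] that by (simp only: section_of_def)
    then show ?thesis
      by (simp only: ver_proj_eq_0_iff neg_equal_0_iff_equal)
  qed
  then show ?thesis
    unfolding totally_geodesic_foliation_def Let_def
    by (intro all_cong1 imp_cong refl, elim conjE, simp only: minus_vertical_part_nabla[OF assms(1)])
qed

end
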